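(* Let $\mathrm{PP}$ be the polynomial program: minimize $f(\mathbf x)$ subject to $g_1(\mathbf x)\le 0,\dots,g_q(\mathbf x)\le 0$ and $\mathbf x\in\Phi_x$, where $f,g_1,\dots,g_q$ are real polynomials in $\mathbf x=(x_1,\dots,x_n)$ and $\Phi_x=\{\mathbf x\in\mathbb R^n:\alpha_i\le x_i\le\beta_i,\ i=1,\dots,n\}$. Let $\mathrm{LP}^-$ be the mixed binary linear program: minimize $\lfloor f\rfloor(\mathbf w)$ subject to $\lfloor g_1\rfloor(\mathbf w)\le0,\dots,\lfloor g_q\rfloor(\mathbf w)\le 0$ and $\mathbf w\in\Phi_w$; and let $\mathrm{LP}^+$ be the mixed binary linear program: minimize $\lceil f\rceil(\mathbf w)$ subject to $\lceil g_1\rceil(\mathbf w)\le0,\dots,\lceil g_q\rceil(\mathbf w)\le 0$ and $\mathbf w\in\Phi_w$ (the set $\Phi_w$, the map $\mathbf x(\cdot)$ and the linear bounds $\lfloor\cdot\rfloor,\lceil\cdot\rceil$ are defined in the context). Then: 1. If $\mathrm{LP}^-$ is infeasible, then $\mathrm{PP}$ is infeasible; if $\mathrm{LP}^+$ is feasible, then $\mathrm{PP}$ is feasible. 2. If $\mathrm{PP}$ is feasible, $\mathbf x^*$ is a global minimizer of $\mathrm{PP}$ and $\mathbf w^-$ is a minimizer of $\mathrm{LP}^-$, then $\lfloor f\rfloor(\mathbf w^-)\le f(\mathbf x^* )$. 3. If $\mathbf w^-$ is a minimizer of $\mathrm{LP}^-$ and the point $\mathbf x(\mathbf w^-)$ satisfies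 $\mathbf x(\mathbf w^-)\in\Phi_x$ and $g_j(\mathbf x(\mathbf w^-))\le0$ for $j=1,\dots,q$, then $f(\mathbf x^* )\le f(\mathbf x(\mathbf w^-))$ for every global minimizer $\mathbf x^*$ of $\mathrm{PP}$. 4. If $\mathrm{LP}^+$ is feasible and $\mathbf w^+$ is a minimizer of $\mathrm{LP}^+$, then $\mathbf x(\mathbf w^+)\in\Phi_x$ and $g_j(\mathbf x(\mathbf w^+))\le 0$ for $j=1,\dots,q$, and for every global minimizer $\mathbf x^*$ of $\mathrm{PP}$, $$f(\mathbf x^* )\le f(\mathbf x(\mathbf w^+))\le\lceil f\rceil(\mathbf w^+).$$
   Context: Variables and parameters. For $i=1,\dots,n$ the real variable $x_i$ has constant bounds $\alpha_i\le x_i\le\beta_i$ (of arbitrary sign). If $\alpha_i<\beta_i$, a constant $\kappa_i$ with $0<\kappa_i\le\beta_i-\alpha_i$ is given and $\sigma_i=\lceil\log_2((\beta_i-\alpha_i)/\kappa_i)\rceil\ge0$; if $\alpha_i=\beta_i$, then $\kappa_i=0$ and $\sigma_i=0$. Introduce binary unit variables $u_{i,j}\in\{0,1\}$ ($1\le j\le\sigma_i$) and a real remainder variable $r_i\in[0,1]$, and set $$x_i(\mathbf w)=\alpha_i+\kappa_i\sum_{j=1}^{\sigma_i}2^{j-1}u_{i,j}+\kappa_i r_i .$$ Monomials and elements. Let $m_1,\dots,m_t$ be the monomials occurring in the problem, $m_k=\prod_{i\in I_k}x_i$, where $I_k$ is a finite tuple of indices from $\{1,\dots,n\}$, possibly with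 repetitions, possibly empty (empty product $=1$). Each polynomial $g$ in the problem is written $g=\sum_{k=1}^t c_k m_k$ with $c_k\in\mathbb R$. Substituting the expressions $x_i(\mathbf w)$ into $m_k$ and distributing the product over the sums (without combining terms or simplifying powers) gives $m_k=z_{k,1}+\dots+z_{k,s_k}$, where each element $z_{k,\ell}$ arises by choosing, for each position of $I_k$ with index $i$, one of the summands $\alpha_i$, $\kappa_i2^{j-1}u_{i,j}$ ($1\le j\le\sigma_i$), $\kappa_i r_i$, and multiplying the choices. For an element $z_{k,\ell}$, let $n_u$ be the number of chosen unit variables $u_{i_1,j_1},\dots,u_{i_{n_u},j_{n_u}}$ and $n_r$ the number of chosen remainder variables $r_{h_1},\dots,r_{h_{n_r}}$ (both counted with multiplicity), and let $n_{k,\ell}=\max(n_r,1)$. Let $a_{k,\ell}$ be $1/n_{k,\ell}$ times the product of all constant factors in the chosen summands (the chosen $\alpha_i$, the $\kappa_i2^{j-1}$ of the chosen unit summands, the $\kappa_i$ of the chosen remainder summands), so that $z_{k,\ell}=a_{k,\ell}n_{k,\ell}\,(u_{i_1,j_1}\cdots u_{i_{n_u},j_{n_u}})(r_{h_1}\cdots r_{h_{n_r}})$. Linearization. For each $(k,\ell)$ and each $h=1,\dots,n_{k,\ell}$ introduce a real unit-product variable $y_{k,\ell,h}\in[0,1]$. Let $\rho_h=r_{h_h}$ denote the $h$-th chosen remainder variable of $z_{k,\ell}$ if $n_r>0$, and $\rho_1=1$ if $n_r=0$. Impose the linear constraints $$y_{k,\ell,h}\le u_{i_p,j_p}\ (p=1,\dots,n_u),\qquad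 y_{k,\ell,h}\le\rho_h,\qquad y_{k,\ell,h}\ge\rho_h+u_{i_1,j_1}+\dots+u_{i_{n_u},j_{n_u}}-n_u .$$ Let $\mathbf w$ be the tuple of all unit, remainder and unit-product variables. $\Phi_w$ is the set of all $\mathbf w$ with $u_{i,j}\in\{0,1\}$, $r_i\in[0,1]$, $y_{k,\ell,h}\in[0,1]$ satisfying all these constraints for all $(k,\ell,h)$ together with $x_i(\mathbf w)\le\beta_i$ for all $i$. Write $\mathbf x(\mathbf w)=(x_1(\mathbf w),\dots,x_n(\mathbf w))$. For a polynomial $g=\sum_kc_km_k$ define the linear function of $\mathbf w$ $$[\![g]\!](\mathbf w)=\sum_{k=1}^t\sum_{\ell=1}^{s_k}\sum_{h=1}^{n_{k,\ell}}c_ka_{k,\ell}\,y_{k,\ell,h},$$ the constants $$E^-(g)=\sum_{(k,\ell):\,c_ka_{k,\ell}<0}c_ka_{k,\ell}(n_{k,\ell}-1),\qquad E^+(g)=\sum_{(k,\ell):\,c_ka_{k,\ell}>0}c_ka_{k,\ell}(n_{k,\ell}-1),$$ and the linear bounds (affine functions of $\mathbf w$, not integer rounding) $\lfloor g\rfloor=[\![g]\!]-E^+(g)$ and $\lceil g\rceil=[\![g]\!]-E^-(g)$. *)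

theory Defs
  imports "HOL-Analysis.Analysis"
begin

section \<open>Problem data\<close>

text \<open>
  The bounds \<open>\<alpha>\<close>, \<open>\<beta>\<close>, the resolutions \<open>\<kappa>\<close>, and the monomials
  \<open>m\<^sub>k\<close> for \<open>k = 1, \<dots>, t\<close>, given by their index tuples \<open>I\<^sub>k\<close> (lists of variable
  indices, possibly with repetitions, possibly empty). Values of \<open>tuple\<close> outside
  \<open>{1..t}\<close> are never used. A polynomial over these monomials is given by its family of
  coefficients \<open>c :: nat \<Rightarrow> real\<close>.
\<close>

record 'n pp_data =
  lower :: "'n \<Rightarrow> real"
  upper :: "'n \<Rightarrow> real"
  kappa :: "'n \<Rightarrow> real"
  num_monomials :: nat
  tuple :: "nat \<Rightarrow> 'n list"

definition valid_data :: "'n pp_data \<Rightarrow> bool" where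
  "valid_data P \<longleftrightarrow> (\<forall>i. lower P i \<le> upper P i \<and>
     (lower P i < upper P i \<longrightarrow> 0 < kappa P i \<and> kappa P i \<le> upper P i - lower P i) \<and>
     (lower P i = upper P i \<longrightarrow> kappa P i = 0))"

definition num_units :: "'n pp_data \<Rightarrow> 'n \<Rightarrow> nat" where
  "num_units P i = (if lower P i < upper P i
     then nat \<lceil>log 2 ((upper P i - lower P i) / kappa P i)\<rceil> else 0)"

definition monomial :: "'n list \<Rightarrow> real ^ 'n \<Rightarrow> real" where
  "monomial I x = (\<Prod>i\<leftarrow>I. x $ i)"

definition poly_val :: "'n pp_data \<Rightarrow> (nat \<Rightarrow> real) \<Rightarrow> real ^ 'n \<Rightarrow> real" where
  "poly_val P c x = (\<Sum>k = 1..num_monomials P. c k * monomial (tuple P k) x)"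

definition Phi_x :: "'n pp_data \<Rightarrow> (real ^ 'n) set" where
  "Phi_x P = {x. \<forall>i. lower P i \<le> x $ i \<and> x $ i \<le> upper P i}"


section \<open>Elements of the expanded monomials\<close>

text \<open>
  The summands of \<open>x\<^sub>i(w)\<close>: \<open>Const i\<close> stands for \<open>\<alpha>\<^sub>i\<close>, \<open>Unit i j\<close> for
  \<open>\<kappa>\<^sub>i 2\<^bsup>j-1\<^esup> u\<^sub>i\<^sub>j\<close>, and \<open>Rem i\<close> for \<open>\<kappa>\<^sub>i r\<^sub>i\<close>.
\<close>

datatype 'n summand = Const 'n | Unit 'n nat | Rem 'n

definition summands :: "'n pp_data \<Rightarrow> 'n \<Rightarrow> 'n summand set" where
  "summands P i = {Const i} \<union> {Unit i j |j. 1 \<le> j \<and> j \<le> num_units P i} \<union> {Rem i}"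

text \<open>
  An element of the expansion of \<open>m\<^sub>k\<close> is identified with the sequence of choices producing
  it, one per position of \<open>I\<^sub>k\<close>. These sequences serve as the index \<open>\<ell>\<close>. Different choices
  are different elements even if their values agree, so no terms are combined.
\<close>

definition elements :: "'n pp_data \<Rightarrow> nat \<Rightarrow> 'n summand list set" where
  "elements P k = listset (map (summands P) (tuple P k))"

fun summand_const :: "'n pp_data \<Rightarrow> 'n summand \<Rightarrow> real" where
  "summand_const P (Const i) = lower P i"
| "summand_const P (Unit i j) = kappa P i * 2 ^ (j - 1)"
| "summand_const P (Rem i) = kappa P i"

fun chosen_units :: "'n summand list \<Rightarrow> ('n \<times> nat) list" where
  "chosen_units [] = []"
| "chosen_units (Unit i j # e) = (i, j) # chosen_units e"
| "chosen_units (_ # e) = chosen_units e"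

fun chosen_rems :: "'n summand list \<Rightarrow> 'n list" where
  "chosen_rems [] = []"
| "chosen_rems (Rem i # e) = i # chosen_rems e"
| "chosen_rems (_ # e) = chosen_rems e"

definition elem_n :: "'n summand list \<Rightarrow> nat" where
  "elem_n e = max (length (chosen_rems e)) 1"

definition elem_a :: "'n pp_data \<Rightarrow> 'n summand list \<Rightarrow> real" where
  "elem_a P e = (1 / real (elem_n e)) * (\<Prod>s\<leftarrow>e. summand_const P s)"


section \<open>Linearization\<close>

text \<open>
  The tuple \<open>w\<close> of unit, remainder and unit-product variables; \<open>yvar w k e h\<close> is
  \<open>y\<close> with index \<open>(k, e, h)\<close>. Only the entries with \<open>1 \<le> j \<le> \<sigma>\<^sub>i\<close>, \<open>1 \<le> k \<le> t\<close>,
  \<open>e \<in> elements P k\<close> and \<open>1 \<le> h \<le> elem_n e\<close> belong to the programs; all others are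
  unconstrained and occur nowhere.
\<close>

record 'n lp_point =
  uvar :: "'n \<Rightarrow> nat \<Rightarrow> real"
  rvar :: "'n \<Rightarrow> real"
  yvar :: "nat \<Rightarrow> 'n summand list \<Rightarrow> nat \<Rightarrow> real"

definition x_of :: "'n pp_data \<Rightarrow> 'n lp_point \<Rightarrow> real ^ 'n" where
  "x_of P w = (\<chi> i. lower P i
     + kappa P i * (\<Sum>j = 1..num_units P i. 2 ^ (j - 1) * uvar w i j) + kappa P i * rvar w i)"

definition rho :: "'n lp_point \<Rightarrow> 'n summand list \<Rightarrow> nat \<Rightarrow> real" where
  "rho w e h = (if chosen_rems e = [] then 1 else rvar w (chosen_rems e ! (h - 1)))"

definition unit_product_constraints ::
    "'n lp_point \<Rightarrow> nat \<Rightarrow> 'n summand list \<Rightarrow> nat \<Rightarrow> bool" where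
  "unit_product_constraints w k e h \<longleftrightarrow>
     (\<forall>(i, j) \<in> set (chosen_units e). yvar w k e h \<le> uvar w i j) \<and>
     yvar w k e h \<le> rho w e h \<and>
     yvar w k e h \<ge> rho w e h + (\<Sum>(i, j)\<leftarrow>chosen_units e. uvar w i j)
       - real (length (chosen_units e))"

definition Phi_w :: "'n::finite pp_data \<Rightarrow> 'n lp_point set" where
  "Phi_w P = {w.
     (\<forall>i. \<forall>j \<in> {1..num_units P i}. uvar w i j \<in> {0, 1}) \<and>
     (\<forall>i. rvar w i \<in> {0..1}) \<and>
     (\<forall>k \<in> {1..num_monomials P}. \<forall>e \<in> elements P k. \<forall>h \<in> {1..elem_n e}.
        yvar w k e h \<in> {0..1} \<and> unit_product_constraints w k e h) \<and>
     (\<forall>i. x_of P w $ i \<le> upper P i)}"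

definition lin :: "'n pp_data \<Rightarrow> (nat \<Rightarrow> real) \<Rightarrow> 'n lp_point \<Rightarrow> real" where
  "lin P c w = (\<Sum>k = 1..num_monomials P. \<Sum>e\<in>elements P k. \<Sum>h = 1..elem_n e.
     c k * elem_a P e * yvar w k e h)"

definition E_minus :: "'n pp_data \<Rightarrow> (nat \<Rightarrow> real) \<Rightarrow> real" where
  "E_minus P c =
     (\<Sum>(k, e) \<in> {(k, e). k \<in> {1..num_monomials P} \<and> e \<in> elements P k \<and> c k * elem_a P e < 0}.
        c k * elem_a P e * (real (elem_n e) - 1))"

definition E_plus :: "'n pp_data \<Rightarrow> (nat \<Rightarrow> real) \<Rightarrow> real" where
  "E_plus P c =
     (\<Sum>(k, e) \<in> {(k, e). k \<in> {1..num_monomials P} \<and> e \<in> elements P k \<and> c k * elem_a P e > 0}.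
        c k * elem_a P e * (real (elem_n e) - 1))"

definition lin_lower :: "'n pp_data \<Rightarrow> (nat \<Rightarrow> real) \<Rightarrow> 'n lp_point \<Rightarrow> real" where
  "lin_lower P c w = lin P c w - E_plus P c"

definition lin_upper :: "'n pp_data \<Rightarrow> (nat \<Rightarrow> real) \<Rightarrow> 'n lp_point \<Rightarrow> real" where
  "lin_upper P c w = lin P c w - E_minus P c"


section \<open>The three programs\<close>

definition PP_feasible ::
    "'n pp_data \<Rightarrow> nat \<Rightarrow> (nat \<Rightarrow> nat \<Rightarrow> real) \<Rightarrow> (real ^ 'n) set" where
  "PP_feasible P q g = {x \<in> Phi_x P. \<forall>j \<in> {1..q}. poly_val P (g j) x \<le> 0}"

definition LP_minus_feasible ::
    "'n::finite pp_data \<Rightarrow> nat \<Rightarrow> (nat \<Rightarrow> nat \<Rightarrow> real) \<Rightarrow> 'n lp_point set" where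
  "LP_minus_feasible P q g = {w \<in> Phi_w P. \<forall>j \<in> {1..q}. lin_lower P (g j) w \<le> 0}"

definition LP_plus_feasible ::
    "'n::finite pp_data \<Rightarrow> nat \<Rightarrow> (nat \<Rightarrow> nat \<Rightarrow> real) \<Rightarrow> 'n lp_point set" where
  "LP_plus_feasible P q g = {w \<in> Phi_w P. \<forall>j \<in> {1..q}. lin_upper P (g j) w \<le> 0}"

definition PP_minimizer :: "'n pp_data \<Rightarrow> nat \<Rightarrow> (nat \<Rightarrow> real) \<Rightarrow> (nat \<Rightarrow> nat \<Rightarrow> real)
    \<Rightarrow> real ^ 'n \<Rightarrow> bool" where
  "PP_minimizer P q f g = is_arg_min (poly_val P f) (\<lambda>x. x \<in> PP_feasible P q g)"

definition LP_minus_minimizer :: "'n::finite pp_data \<Rightarrow> nat \<Rightarrow> (nat \<Rightarrow> real)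
    \<Rightarrow> (nat \<Rightarrow> nat \<Rightarrow> real) \<Rightarrow> 'n lp_point \<Rightarrow> bool" where
  "LP_minus_minimizer P q f g = is_arg_min (lin_lower P f) (\<lambda>w. w \<in> LP_minus_feasible P q g)"

definition LP_plus_minimizer :: "'n::finite pp_data \<Rightarrow> nat \<Rightarrow> (nat \<Rightarrow> real)
    \<Rightarrow> (nat \<Rightarrow> nat \<Rightarrow> real) \<Rightarrow> 'n lp_point \<Rightarrow> bool" where
  "LP_plus_minimizer P q f g = is_arg_min (lin_upper P f) (\<lambda>w. w \<in> LP_plus_feasible P q g)"


section \<open>Consistency of the expansion\<close>

lemma summands_eq:
  "summands P i = insert (Const i) (insert (Rem i) (Unit i ` {1..num_units P i}))"
  by (auto simp: summands_def)

lemma finite_summands: "finite (summands P i)"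
  by (simp add: summands_eq)

lemma finite_elements: "finite (elements P k)"
proof -
  have "finite (listset (map (summands P) I))" for I
    by (induction I) (auto simp: set_Cons_def finite_summands
        intro!: finite_image_set2[where P = "\<lambda>x. x \<in> _" and Q = "\<lambda>xs. xs \<in> _"])
  then show ?thesis by (simp add: elements_def)
qed

fun summand_val :: "'n pp_data \<Rightarrow> 'n lp_point \<Rightarrow> 'n summand \<Rightarrow> real" where
  "summand_val P w (Const i) = lower P i"
| "summand_val P w (Unit i j) = kappa P i * 2 ^ (j - 1) * uvar w i j"
| "summand_val P w (Rem i) = kappa P i * rvar w i"

lemma sum_summands: "(\<Sum>s\<in>summands P i. summand_val P w s) = x_of P w $ i"
proof -
  have "(\<Sum>s\<in>Unit i ` {1..num_units P i}. summand_val P w s)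
      = kappa P i * (\<Sum>j = 1..num_units P i. 2 ^ (j - 1) * uvar w i j)"
    by (subst sum.reindex) (auto simp: inj_on_def sum_distrib_left mult.assoc)
  then show ?thesis
    by (simp add: summands_eq x_of_def sum.insert image_iff)
qed

text \<open>Each monomial is the sum of its elements \<open>z\<close>.\<close>

lemma monomial_eq_sum_elements:
  "monomial (tuple P k) (x_of P w) = (\<Sum>e\<in>elements P k. \<Prod>s\<leftarrow>e. summand_val P w s)"
proof -
  have "monomial I (x_of P w)
      = (\<Sum>e\<in>listset (map (summands P) I). \<Prod>s\<leftarrow>e. summand_val P w s)" for I
  proof (induction I)
    case Nil
    show ?case by (simp add: monomial_def)
  next
    case (Cons i I)
    let ?L = "listset (map (summands P) I)"
    have "set_Cons (summands P i) ?L = (\<lambda>(s, e). s # e) ` (summands P i \<times> ?L)"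
      by (auto simp: set_Cons_def)
    moreover have "inj_on (\<lambda>(s, e). s # e) (summands P i \<times> ?L)"
      by (auto simp: inj_on_def)
    ultimately have "(\<Sum>e\<in>listset (map (summands P) (i # I)). \<Prod>s\<leftarrow>e. summand_val P w s)
        = (\<Sum>(s, e)\<in>summands P i \<times> ?L. summand_val P w s * (\<Prod>s\<leftarrow>e. summand_val P w s))"
      by (simp only: list.map listset.simps)
        (simp add: sum.reindex case_prod_beta[abs_def])
    also have "\<dots> = x_of P w $ i * monomial I (x_of P w)"
      by (simp add: sum.cartesian_product[symmetric] sum_product[symmetric] sum_summands Cons.IH)
    finally show ?case by (simp add: monomial_def)
  qed
  then show ?thesis by (simp add: elements_def)
qed

text \<open>Factorization of an element into \<open>a\<close>, \<open>n\<close>, its unit and its remainder variables.\<close>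

lemma element_factorization:
  "(\<Prod>s\<leftarrow>e. summand_val P w s) = elem_a P e * real (elem_n e)
     * (\<Prod>(i, j)\<leftarrow>chosen_units e. uvar w i j) * (\<Prod>i\<leftarrow>chosen_rems e. rvar w i)"
proof -
  have "(\<Prod>s\<leftarrow>e. summand_val P w s) = (\<Prod>s\<leftarrow>e. summand_const P s)
     * (\<Prod>(i, j)\<leftarrow>chosen_units e. uvar w i j) * (\<Prod>i\<leftarrow>chosen_rems e. rvar w i)"
  proof (induction e)
    case (Cons s e)
    then show ?case by (cases s) (simp_all add: mult_ac)
  qed simp
  moreover have "elem_n e \<noteq> 0" by (simp add: elem_n_def)
  ultimately show ?thesis by (simp add: elem_a_def)
qed

end

(* Integrality of the units makes the linear constraints exact: on Phi_w every unit-product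
   variable equals (product of units) * rho_h. The only loss is thus in replacing the product of n
   remainders in [0,1], times n, by their sum, and
     n * (r_1 ... r_n) <= r_1 + ... + r_n <= n * (r_1 ... r_n) + (n - 1).
   The sign of the coefficient decides which side contributes to E^+ or E^-; summing up,
   lin_lower g w <= g (x w) <= lin_upper g w on Phi_w. Binary expansion shows that x maps
   Phi_w onto Phi_x, and the theorem follows. *)
theory Submission imports Defs begin

section \<open>Products and sums of numbers in the unit interval\<close>

lemma prod_list_unit_interval:
  fixes rs :: "real list"
  assumes "set rs \<subseteq> {0..1}"
  shows "prod_list rs \<in> {0..1}"
  using assms by (induction rs) (auto intro: mult_le_one)

text \<open>With all factors in [0,1] the product is at most each single entry; adding this over the
  entries gives the bound.\<close>

lemma length_mult_prod_list_le_sum_list: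
  fixes rs :: "real list"
  assumes "set rs \<subseteq> {0..1}"
  shows "real (length rs) * prod_list rs \<le> sum_list rs"
  using assms
proof (induction rs)
  case (Cons r rs)
  then have IH: "real (length rs) * prod_list rs \<le> sum_list rs"
    and r: "0 \<le> r" "r \<le> 1" and p: "prod_list rs \<in> {0..1}"
    using prod_list_unit_interval[of rs] by auto
  have "r * (real (length rs) * prod_list rs) \<le> real (length rs) * prod_list rs"
    using r p by (intro mult_left_le_one_le) auto
  moreover have "r * prod_list rs \<le> r"
    using r p by (intro mult_left_le) auto
  ultimately show ?case using IH by (simp add: algebra_simps)
qed simp

text \<open>Since \<open>(1 - r) * (1 - p) \<ge> 0\<close> means
  \<open>r + p \<le> r * p + 1\<close>, absorbing one more factor into the product costs at most 1.
  The empty list gives equality, 0 = 1 + (0 - 1).\<close>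

lemma sum_list_le_prod_list:
  fixes rs :: "real list"
  assumes "set rs \<subseteq> {0..1}"
  shows "sum_list rs \<le> prod_list rs + (real (length rs) - 1)"
  using assms
proof (induction rs)
  case (Cons r rs)
  then have IH: "sum_list rs \<le> prod_list rs + (real (length rs) - 1)"
    and r: "0 \<le> r" "r \<le> 1" and p: "prod_list rs \<in> {0..1}"
    using prod_list_unit_interval[of rs] by auto
  have "0 \<le> (1 - r) * (1 - prod_list rs)" using r p by simp
  then show ?case using IH by (simp add: algebra_simps)
qed simp

text \<open>The form in which integrality of the units is used: the lower constraint on
  \<open>y\<close> has right-hand side \<open>rho\<close> in the first case and at most
  \<open>rho - 1\<close> in the second.\<close>

lemma binary_list_cases:
  fixes bs :: "real list"
  assumes "set bs \<subseteq> {0, 1}"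
  obtains "prod_list bs = 1" "sum_list bs = real (length bs)" "set bs \<subseteq> {1}"
  | "prod_list bs = 0" "sum_list bs \<le> real (length bs) - 1" "0 \<in> set bs"
proof -
  have "(prod_list bs = 1 \<and> sum_list bs = real (length bs) \<and> set bs \<subseteq> {1}) \<or>
    (prod_list bs = 0 \<and> sum_list bs \<le> real (length bs) - 1 \<and> 0 \<in> set bs)"
    using assms by (induction bs) auto
  then show thesis using that by blast
qed

text \<open>Digits are chosen greedily from the top. As \<open>r = 1\<close> is allowed, the
  endpoint \<open>t = 2 ^ s\<close> is reached too, with all digits 1.\<close>

lemma binary_expansion_exists:
  fixes t :: real
  assumes "0 \<le> t" "t \<le> 2 ^ s"
  shows "\<exists>b r. (\<forall>j. b j \<in> {0, 1}) \<and> r \<in> {0..1} \<and>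
    t = (\<Sum>j = 1..s. 2 ^ (j - 1) * b j) + r"
  using assms
proof (induction s arbitrary: t)
  case 0
  then show ?case by (intro exI[of _ "\<lambda>_. 0"] exI[of _ t]) simp
next
  case (Suc s)
  \<comment> \<open>The new digit has weight \<open>2 ^ s\<close> and is set only if
    \<open>t\<close> exceeds it, so the rest stays in the range of the induction hypothesis.\<close>
  define d :: real where "d = (if t \<le> 2 ^ s then 0 else 1)"
  have "0 \<le> t - 2 ^ s * d" "t - 2 ^ s * d \<le> 2 ^ s"
    using Suc.prems by (auto simp: d_def)
  from Suc.IH[OF this] obtain b r where b: "\<forall>j. b j \<in> {0, 1}" "r \<in> {0..1}"
    and t: "t - 2 ^ s * d = (\<Sum>j = 1..s. 2 ^ (j - 1) * b j) + r" by blast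
  have "(\<Sum>j = 1..s. 2 ^ (j - 1) * (b(Suc s := d)) j) = (\<Sum>j = 1..s. 2 ^ (j - 1) * b j)"
    by (rule sum.cong) auto
  then have "t = (\<Sum>j = 1..Suc s. 2 ^ (j - 1) * (b(Suc s := d)) j) + r"
    using t by simp
  moreover have "\<forall>j. (b(Suc s := d)) j \<in> {0, 1}"
    using b by (simp add: d_def)
  ultimately show ?case using b(2) by blast
qed

section \<open>The linear bounds on the feasible set\<close>

lemma kappa_nonneg: "valid_data P \<Longrightarrow> 0 \<le> kappa P i"
  unfolding valid_data_def by (metis less_eq_real_def)

text \<open>\<open>Phi_w\<close> makes \<open>uvar w i j\<close> binary only for these
  \<open>j\<close>, so integrality applies to every unit of an element.\<close>

lemma chosen_units_elements:
  assumes "e \<in> elements P k" "(i, j) \<in> set (chosen_units e)"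
  shows "j \<in> {1..num_units P i}"
proof -
  have "e \<in> listset (map (summands P) I) \<Longrightarrow> (i, j) \<in> set (chosen_units e) \<Longrightarrow>
      j \<in> {1..num_units P i}" for I
    by (induction I arbitrary: e) (auto simp: set_Cons_def summands_def)
  then show ?thesis using assms by (auto simp: elements_def)
qed

lemma unit_values_binary:
  assumes "\<forall>i. \<forall>j \<in> {1..num_units P i}. uvar w i j \<in> {0, 1}" "e \<in> elements P k"
  shows "set (map (\<lambda>(i, j). uvar w i j) (chosen_units e)) \<subseteq> {0, 1}"
  using assms(1) chosen_units_elements[OF assms(2)] by fastforce

lemma rho_unit_interval:
  assumes "\<forall>i. rvar w i \<in> {0..1}"
  shows "rho w e h \<in> {0..1}"
  using assms by (auto simp: rho_def)

text \<open>If all units are 1, the constraints squeeze \<open>y\<close> between \<open>rho\<close>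
  and \<open>rho\<close>; if some unit is 0, then \<open>y \<le> 0\<close>, and \<open>y\<close> is
  nonnegative by its range.\<close>

lemma unit_product_eq:
  assumes "w \<in> Phi_w P" "k \<in> {1..num_monomials P}" "e \<in> elements P k" "h \<in> {1..elem_n e}"
  shows "yvar w k e h = (\<Prod>(i, j)\<leftarrow>chosen_units e. uvar w i j) * rho w e h"
proof -
  let ?us = "map (\<lambda>(i, j). uvar w i j) (chosen_units e)"
  have c: "unit_product_constraints w k e h" "yvar w k e h \<in> {0..1}"
    using assms by (auto simp: Phi_w_def)
  have "set ?us \<subseteq> {0, 1}"
    using assms by (intro unit_values_binary) (auto simp: Phi_w_def)
  then show ?thesis
  proof (cases rule: binary_list_cases)
    case 1
    then show ?thesis using c by (auto simp: unit_product_constraints_def)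
  next
    case 2
    then have "yvar w k e h \<le> 0"
      using c by (force simp: unit_product_constraints_def)
    then show ?thesis using c 2 by simp
  qed
qed

text \<open>\<open>rho\<close> counts from 1 and lists from 0. Without remainders
  \<open>elem_n\<close> is still 1, and the single \<open>rho\<close> equals 1.\<close>

lemma sum_rho:
  "(\<Sum>h = 1..elem_n e. rho w e h) =
     (if chosen_rems e = [] then 1 else sum_list (map (rvar w) (chosen_rems e)))"
proof (cases "chosen_rems e = []")
  case False
  then have "elem_n e = length (chosen_rems e)"
    by (cases "chosen_rems e") (auto simp: elem_n_def)
  then have "(\<Sum>h = 1..elem_n e. rho w e h) =
      (\<Sum>h<length (chosen_rems e). rvar w (chosen_rems e ! h))"
    using False by (simp add: sum.atLeast1_atMost_eq rho_def)
  then show ?thesis using False by (simp add: sum_list_sum_nth atLeast0LessThan)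
qed (simp add: elem_n_def rho_def)

text \<open>By exactness the sum of the \<open>y\<close> is the unit product times the sum of the
  \<open>rho\<close>. A unit product 1 leaves the bounds for remainders; a unit product 0 leaves
  \<open>0 \<le> 0 \<le> n - 1\<close>.\<close>

lemma element_bounds:
  assumes "w \<in> Phi_w P" "k \<in> {1..num_monomials P}" "e \<in> elements P k"
  defines "z \<equiv> (\<Prod>(i, j)\<leftarrow>chosen_units e. uvar w i j) * (\<Prod>i\<leftarrow>chosen_rems e. rvar w i)"
  shows "real (elem_n e) * z \<le> (\<Sum>h = 1..elem_n e. yvar w k e h)"
    and "(\<Sum>h = 1..elem_n e. yvar w k e h) \<le> real (elem_n e) * z + (real (elem_n e) - 1)"
proof -
  let ?rs = "map (rvar w) (chosen_rems e)"
  let ?U = "\<Prod>(i, j)\<leftarrow>chosen_units e. uvar w i j"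
  let ?p = "prod_list ?rs"
  let ?n = "real (elem_n e)"
  define S where "S = (\<Sum>h = 1..elem_n e. rho w e h)"
  have y: "(\<Sum>h = 1..elem_n e. yvar w k e h) = ?U * S"
    using unit_product_eq[OF assms(1-3)] by (simp add: S_def sum_distrib_left)
  have rs: "set ?rs \<subseteq> {0..1}" using assms(1) by (auto simp: Phi_w_def)
  have n: "1 \<le> ?n" by (simp add: elem_n_def)
  have lo_hi: "?n * ?p \<le> S" "S \<le> ?p + (?n - 1)"
  proof (atomize (full), cases "chosen_rems e = []")
    case True
    then show "?n * ?p \<le> S \<and> S \<le> ?p + (?n - 1)"
      unfolding S_def sum_rho by (simp add: elem_n_def)
  next
    case False
    then have "elem_n e = length ?rs"
      by (cases "chosen_rems e") (auto simp: elem_n_def)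
    then show "?n * ?p \<le> S \<and> S \<le> ?p + (?n - 1)"
      using False length_mult_prod_list_le_sum_list[OF rs] sum_list_le_prod_list[OF rs]
      unfolding S_def sum_rho by simp
  qed
  \<comment> \<open>The element carries \<open>n * p\<close> rather than \<open>p\<close>; this
    weakening yields the gap \<open>n - 1\<close> found in \<open>E_plus\<close> and
    \<open>E_minus\<close>.\<close>
  have "?p \<le> ?n * ?p"
    using n prod_list_unit_interval[OF rs] mult_right_mono[of 1 ?n ?p] by simp
  then have hi: "S \<le> ?n * ?p + (?n - 1)" using lo_hi(2) by linarith
  have "set (map (\<lambda>(i, j). uvar w i j) (chosen_units e)) \<subseteq> {0, 1}"
    using assms(1,3) by (intro unit_values_binary) (auto simp: Phi_w_def)
  then have U: "?U = 0 \<or> ?U = 1"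
    by (cases rule: binary_list_cases) auto
  then show "?n * z \<le> (\<Sum>h = 1..elem_n e. yvar w k e h)"
    and "(\<Sum>h = 1..elem_n e. yvar w k e h) \<le> ?n * z + (?n - 1)"
    using lo_hi(1) hi n unfolding y z_def by auto
qed

text \<open>Gives the error constants the double-sum shape of \<open>lin\<close>, so that the bounds
  can be compared term by term.\<close>

lemma sum_monomial_elements:
  fixes F :: "nat \<Rightarrow> 'n summand list \<Rightarrow> real"
  shows "(\<Sum>(k, e) \<in> {(k, e). k \<in> {1..num_monomials P} \<and> e \<in> elements P k \<and> Q k e}. F k e) =
    (\<Sum>k = 1..num_monomials P. \<Sum>e\<in>elements P k. if Q k e then F k e else 0)"
proof -
  have "{(k, e). k \<in> {1..num_monomials P} \<and> e \<in> elements P k \<and> Q k e} =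
      (SIGMA k:{1..num_monomials P}. elements P k) \<inter> {(k, e). Q k e}"
    by auto
  then show ?thesis
    by (simp add: sum.inter_restrict finite_elements sum.Sigma case_prod_beta)
qed

lemma lin_bounds:
  assumes "w \<in> Phi_w P"
  shows "lin_lower P c w \<le> poly_val P c (x_of P w)"
    and "poly_val P c (x_of P w) \<le> lin_upper P c w"
proof -
  define z where "z e =
    (\<Prod>(i, j)\<leftarrow>chosen_units e. uvar w i j) * (\<Prod>i\<leftarrow>chosen_rems e. rvar w i)" for e
  define Y where "Y k e = (\<Sum>h = 1..elem_n e. yvar w k e h)" for k e
  have p: "poly_val P c (x_of P w) =
      (\<Sum>k = 1..num_monomials P. \<Sum>e\<in>elements P k. c k * elem_a P e * (real (elem_n e) * z e))"
    by (simp add: poly_val_def monomial_eq_sum_elements element_factorization z_def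
        sum_distrib_left mult.assoc)
  have l: "lin P c w = (\<Sum>k = 1..num_monomials P. \<Sum>e\<in>elements P k. c k * elem_a P e * Y k e)"
    by (simp add: lin_def Y_def sum_distrib_left)
  have b: "real (elem_n e) * z e \<le> Y k e" "Y k e \<le> real (elem_n e) * z e + (real (elem_n e) - 1)"
    if "k \<in> {1..num_monomials P}" "e \<in> elements P k" for k e
    using element_bounds[OF assms that] by (auto simp: z_def Y_def)
  \<comment> \<open>For \<open>a > 0\<close> the excess of \<open>a * s\<close> over
    \<open>a * m\<close> is at most \<open>a * d\<close>, which is subtracted; for
    \<open>a < 0\<close> the order flips and \<open>a * s \<le> a * m\<close> already. The upper
    bound is the mirror image.\<close>
  have scale_lower: "a * s - (if a > 0 then a * d else 0) \<le> a * m"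
    and scale_upper: "a * m \<le> a * s - (if a < 0 then a * d else 0)"
    if "m \<le> s" "s \<le> m + d" for a m s d :: real
  proof -
    have "a \<ge> 0 \<Longrightarrow> a * m \<le> a * s \<and> a * s \<le> a * (m + d)"
      "a \<le> 0 \<Longrightarrow> a * s \<le> a * m \<and> a * (m + d) \<le> a * s"
      using that by (auto intro: mult_left_mono mult_left_mono_neg)
    then show "a * s - (if a > 0 then a * d else 0) \<le> a * m"
      "a * m \<le> a * s - (if a < 0 then a * d else 0)"
      by (cases a "0 :: real" rule: linorder_cases; simp add: distrib_left)+
  qed
  show "lin_lower P c w \<le> poly_val P c (x_of P w)"
    unfolding lin_lower_def E_plus_def sum_monomial_elements p l sum_subtractf[symmetric]
    by (intro sum_mono scale_lower b)
  show "poly_val P c (x_of P w) \<le> lin_upper P c w"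
    unfolding lin_upper_def E_minus_def sum_monomial_elements p l sum_subtractf[symmetric]
    by (intro sum_mono scale_upper b)
qed

section \<open>The box as the image of the linearized feasible set\<close>

text \<open>All terms added to \<open>lower P i\<close> are nonnegative. The upper bound is a
  constraint of \<open>Phi_w\<close>, since the expansion can reach
  \<open>lower P i + kappa P i * 2 ^ num_units P i\<close>, possibly beyond
  \<open>upper P i\<close>.\<close>

lemma x_of_in_Phi_x:
  assumes "valid_data P" "w \<in> Phi_w P"
  shows "x_of P w \<in> Phi_x P"
proof -
  have w: "\<forall>i. \<forall>j \<in> {1..num_units P i}. uvar w i j \<in> {0, 1}" "\<And>i. 0 \<le> rvar w i"
    "\<And>i. x_of P w $ i \<le> upper P i"
    using assms(2) by (auto simp: Phi_w_def)
  have "lower P i \<le> x_of P w $ i" for i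
  proof -
    have "0 \<le> uvar w i j" if "j \<in> {1..num_units P i}" for j
      using bspec[OF spec[OF w(1)] that] by auto
    then have "0 \<le> (\<Sum>j = 1..num_units P i. 2 ^ (j - 1) * uvar w i j)"
      by (intro sum_nonneg) simp
    then show ?thesis
      using kappa_nonneg[OF assms(1), of i] w(2)[of i] by (simp add: x_of_def)
  qed
  then show ?thesis using w(3) by (simp add: Phi_x_def)
qed

text \<open>The offset of \<open>x $ i\<close> in units of \<open>kappa P i\<close> is at most
  \<open>2 ^ num_units P i\<close>, because \<open>num_units\<close> rounds the binary logarithm up;
  so it has a binary expansion.\<close>

lemma coordinate_expansion_exists:
  assumes "valid_data P" "x \<in> Phi_x P"
  shows "\<exists>b r. (\<forall>j. b j \<in> {0, 1}) \<and> r \<in> {0..1} \<and>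
    x $ i = lower P i + kappa P i * (\<Sum>j = 1..num_units P i. 2 ^ (j - 1) * b j) + kappa P i * r"
proof (cases "lower P i < upper P i")
  case True
  then have k: "0 < kappa P i" "kappa P i \<le> upper P i - lower P i"
    using assms(1) by (auto simp: valid_data_def)
  let ?q = "(upper P i - lower P i) / kappa P i"
  let ?t = "(x $ i - lower P i) / kappa P i"
  have x: "lower P i \<le> x $ i" "x $ i \<le> upper P i" using assms(2) by (auto simp: Phi_x_def)
  have q: "0 < ?q" using k True by simp
  have "?t \<le> ?q" using k x by (intro divide_right_mono) auto
  also have "?q = 2 powr (log 2 ?q)" using q by simp
  also have "\<dots> \<le> 2 powr real (num_units P i)"
    using True by (intro powr_mono) (auto simp: num_units_def intro: real_nat_ceiling_ge)
  also have "\<dots> = 2 ^ num_units P i" by (simp add: powr_realpow)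
  finally have "?t \<le> 2 ^ num_units P i" .
  moreover have "0 \<le> ?t" using k x by simp
  ultimately obtain b r where br: "\<forall>j. b j \<in> {0, 1}" "r \<in> {0..1}"
    and t: "?t = (\<Sum>j = 1..num_units P i. 2 ^ (j - 1) * b j) + r"
    using binary_expansion_exists by blast
  have "x $ i = lower P i + kappa P i * ?t" using k by simp
  then show ?thesis using br unfolding t by (auto simp: distrib_left)
next
  case False
  then have "lower P i = upper P i" "kappa P i = 0"
    using assms(1) by (auto simp: valid_data_def intro: antisym)
  moreover have "lower P i \<le> x $ i" "x $ i \<le> upper P i"
    using assms(2) by (auto simp: Phi_x_def)
  ultimately show ?thesis
    by (intro exI[of _ "\<lambda>_. 0"] exI[of _ 0]) simp
qed

text \<open>Units and remainders come from the expansions of the coordinates, and each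
  \<open>y\<close> is set to the value that \<open>unit_product_eq\<close> forces.\<close>

lemma Phi_x_lift:
  fixes P :: "'n::finite pp_data"
  assumes "valid_data P" "x \<in> Phi_x P"
  obtains w where "w \<in> Phi_w P" "x_of P w = x"
proof -
  have "\<forall>i. \<exists>b r. (\<forall>j. b j \<in> {0, 1}) \<and> r \<in> {0..1} \<and> x $ i = lower P i
      + kappa P i * (\<Sum>j = 1..num_units P i. 2 ^ (j - 1) * b j) + kappa P i * r"
    using coordinate_expansion_exists[OF assms] by blast
  then obtain b r where b: "\<And>i j. b i j \<in> {0, 1}" and r: "\<And>i. r i \<in> {0..1}"
    and x: "\<And>i. x $ i = lower P i
      + kappa P i * (\<Sum>j = 1..num_units P i. 2 ^ (j - 1) * b i j) + kappa P i * r i"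
    unfolding choice_iff by blast
  \<comment> \<open>\<open>rho\<close> takes a whole point but reads only \<open>rvar\<close>; the
    auxiliary point avoids a circular definition of \<open>yvar\<close>.\<close>
  define w0 :: "'n lp_point" where "w0 = \<lparr>uvar = b, rvar = r, yvar = \<lambda>_ _ _. 0\<rparr>"
  define w where
    "w = w0\<lparr>yvar := \<lambda>k e h. (\<Prod>(i, j)\<leftarrow>chosen_units e. b i j) * rho w0 e h\<rparr>"
  have w: "uvar w = b" "rvar w = r" by (auto simp: w_def w0_def)
  have rho: "rho w0 e h = rho w e h" for e h by (simp add: rho_def w_def)
  have y: "yvar w k e h = (\<Prod>(i, j)\<leftarrow>chosen_units e. b i j) * rho w e h" for k e h
    unfolding rho[symmetric] by (simp add: w_def)
  have xw: "x_of P w = x"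
    by (simp add: vec_eq_iff x_of_def w x)
  have "yvar w k e h \<in> {0..1} \<and> unit_product_constraints w k e h" for k e h
  proof -
    let ?us = "map (\<lambda>(i, j). b i j) (chosen_units e)"
    have rh: "0 \<le> rho w e h" "rho w e h \<le> 1"
      using rho_unit_interval[of w e h] r by (auto simp: w)
    have us: "set ?us \<subseteq> {0, 1}" using b by auto
    then show ?thesis
    proof (cases rule: binary_list_cases)
      case 1
      then show ?thesis using rh by (auto simp: unit_product_constraints_def y w)
    next
      case 2
      \<comment> \<open>Here \<open>y = 0\<close>: nonnegative units give the upper constraints, and
        the lower one reduces to \<open>rho \<le> 1\<close>.\<close>
      have "0 \<le> b i j" for i j using b[of i j] by auto
      then show ?thesis using 2 rh by (auto simp: unit_product_constraints_def y w)
    qed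
  qed
  then have "w \<in> Phi_w P"
    using b r assms(2) unfolding Phi_w_def by (auto simp: w xw Phi_x_def)
  then show thesis using xw that by blast
qed

section \<open>Feasible points carried between the programs\<close>

lemma x_of_LP_plus_feasible:
  assumes "valid_data P" "w \<in> LP_plus_feasible P q g"
  shows "x_of P w \<in> PP_feasible P q g"
proof -
  have w: "w \<in> Phi_w P" "\<And>j. j \<in> {1..q} \<Longrightarrow> lin_upper P (g j) w \<le> 0"
    using assms(2) by (auto simp: LP_plus_feasible_def)
  then show ?thesis
    using x_of_in_Phi_x[OF assms(1)] order_trans[OF lin_bounds(2)[OF w(1)] w(2)]
    by (simp add: PP_feasible_def)
qed

text \<open>Any lift works, since \<open>lin_lower\<close> underestimates each constraint
  polynomial.\<close>

lemma PP_feasible_lift: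
  assumes "valid_data P" "x \<in> PP_feasible P q g"
  obtains w where "w \<in> LP_minus_feasible P q g" "x_of P w = x"
proof -
  have "x \<in> Phi_x P" using assms(2) by (simp add: PP_feasible_def)
  then obtain w where w: "w \<in> Phi_w P" "x_of P w = x"
    using Phi_x_lift[OF assms(1)] by blast
  have "poly_val P (g j) (x_of P w) \<le> 0" if "j \<in> {1..q}" for j
    using assms(2) that by (simp add: PP_feasible_def w)
  then have "w \<in> LP_minus_feasible P q g"
    using w(1) order_trans[OF lin_bounds(1)[OF w(1)]] by (simp add: LP_minus_feasible_def)
  then show thesis using w(2) that by blast
qed

theorem mainTheorem1:
  fixes P :: "'n::finite pp_data"
    and q :: nat
    and f :: "nat \<Rightarrow> real"
    and g :: "nat \<Rightarrow> nat \<Rightarrow> real"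
  assumes "valid_data P"
  shows
    "((LP_minus_feasible P q g = {} \<longrightarrow> PP_feasible P q g = {}) \<and>
      (LP_plus_feasible P q g \<noteq> {} \<longrightarrow> PP_feasible P q g \<noteq> {}))
    \<and>
     (\<forall>xs wm. PP_feasible P q g \<noteq> {} \<and> PP_minimizer P q f g xs \<and> LP_minus_minimizer P q f g wm
        \<longrightarrow> lin_lower P f wm \<le> poly_val P f xs)
    \<and>
     (\<forall>wm. LP_minus_minimizer P q f g wm \<and> x_of P wm \<in> Phi_x P \<and>
          (\<forall>j \<in> {1..q}. poly_val P (g j) (x_of P wm) \<le> 0)
        \<longrightarrow> (\<forall>xs. PP_minimizer P q f g xs \<longrightarrow> poly_val P f xs \<le> poly_val P f (x_of P wm)))
    \<and>
     (\<forall>wp. LP_plus_feasible P q g \<noteq> {} \<and> LP_plus_minimizer P q f g wp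
        \<longrightarrow> x_of P wp \<in> Phi_x P \<and>
            (\<forall>j \<in> {1..q}. poly_val P (g j) (x_of P wp) \<le> 0) \<and>
            (\<forall>xs. PP_minimizer P q f g xs
               \<longrightarrow> poly_val P f xs \<le> poly_val P f (x_of P wp) \<and>
                   poly_val P f (x_of P wp) \<le> lin_upper P f wp))"
proof -
  note plus = x_of_LP_plus_feasible[OF assms]
  have min_le: "poly_val P f xs \<le> poly_val P f x"
    if "PP_minimizer P q f g xs" "x \<in> PP_feasible P q g" for xs x
    using that by (auto simp: PP_minimizer_def is_arg_min_linorder)
  have minus: "lin_lower P f wm \<le> poly_val P f xs"
    if "PP_minimizer P q f g xs" "LP_minus_minimizer P q f g wm" for xs wm
  proof -
    have "xs \<in> PP_feasible P q g"
      using that(1) by (simp add: PP_minimizer_def is_arg_min_linorder)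
    \<comment> \<open>The lift of \<open>xs\<close> competes with \<open>wm\<close> in the relaxed
      program; \<open>x_of P wm\<close> itself may violate the original constraints.\<close>
    then obtain w where w: "w \<in> LP_minus_feasible P q g" "x_of P w = xs"
      using PP_feasible_lift[OF assms] by blast
    then have "lin_lower P f wm \<le> lin_lower P f w"
      using that(2) by (simp add: LP_minus_minimizer_def is_arg_min_linorder)
    also have "\<dots> \<le> poly_val P f xs"
      using w lin_bounds(1)[of w P f] by (simp add: LP_minus_feasible_def)
    finally show ?thesis .
  qed
  have wp: "wp \<in> LP_plus_feasible P q g" "wp \<in> Phi_w P" if "LP_plus_minimizer P q f g wp" for wp
    using that by (auto simp: LP_plus_minimizer_def is_arg_min_linorder LP_plus_feasible_def)
  have feasibility:
    "LP_minus_feasible P q g = {} \<Longrightarrow> PP_feasible P q g = {}"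
    "LP_plus_feasible P q g \<noteq> {} \<Longrightarrow> PP_feasible P q g \<noteq> {}"
    using PP_feasible_lift[OF assms] plus by blast+
  have above: "poly_val P f xs \<le> poly_val P f x"
    if "PP_minimizer P q f g xs" "x \<in> Phi_x P" "\<forall>j \<in> {1..q}. poly_val P (g j) x \<le> 0" for xs x
    using min_le that by (simp add: PP_feasible_def)
  have wp_feasible: "x_of P wp \<in> Phi_x P" "\<forall>j \<in> {1..q}. poly_val P (g j) (x_of P wp) \<le> 0"
    if "LP_plus_minimizer P q f g wp" for wp
    using plus[OF wp(1)[OF that]] by (simp_all add: PP_feasible_def)
  show ?thesis
    by (intro conjI allI impI ballI; (elim conjE)?)
      (rule feasibility minus above min_le[OF _ plus[OF wp(1)]] lin_bounds(2)[OF wp(2)]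
        wp_feasible wp_feasible(2)[THEN bspec]; assumption)+
qed

end
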